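(* Let $k\ge 1$ and let $\mathcal{X}$ be a collection of $n$ distinct $k$-element subsets of a ground set. Let $\mathcal{A}\subseteq\mathcal{X}$ be a packing such that (i) $\mathcal{A}$ is maximal, i.e. every set of $\mathcal{X}\setminus\mathcal{A}$ intersects some set of $\mathcal{A}$, and (ii) the auxiliary multigraph $G_{\mathcal{A}}$ (defined in the context) contains no canonical $t$-improvement for any $t\le 4\log_2 n+1$. (These are the termination conditions of the paper's local search algorithm, and $\mathcal{A}$ is its output.) Then for every packing $\mathcal{B}\subseteq\mathcal{X}$, $$|\mathcal{B}|\le \frac{k+2}{3}\,|\mathcal{A}|.$$
   Context: A packing is a subcollection of $\mathcal{X}$ whose sets are pairwise disjoint; two sets conflict if they share an element. For a packing $\mathcal{A}$, the auxiliary multigraph $G_{\mathcal{A}}$ has vertex set $\mathcal{A}$ and the following edges, each of which "corresponds" to a set of $\mathcal{X}$: for each $X\in\mathcal{X}\setminus\mathcal{A}$ that conflicts with exactly two sets $S,T\in\mathcal{A}$, a separate edge $\{S,T\}$ corresponding to $X$; for each $X\in\mathcal{X}\setminus\mathcal{A}$ that conflicts with exactly one set $S\in\mathcal{A}$, a loop at $S$ corresponding to $X$; and for each $S\in\mathcal{A}$ a loop at $S$ corresponding to $S$ itself (by convention each set of $\mathcal{A}$ conflicts with itself). A set $I$ of $t$ edges of $G_{\mathcal{A}}$ is a $t$-improvement if $I$ covers at most $t-1$ vertices of $G_{\mathcal{A}}$ and the sets corresponding to the edges of $I$ are mutually disjoint. It is canonical if the subgraph formed by the edges of $I$ is connected and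 contains two distinct cycles (loops count as cycles of length 1 and two parallel edges as a cycle of length 2); i.e. it consists of two edge-disjoint cycles joined by a path, or two edge-disjoint cycles sharing a single vertex, or two distinct vertices joined by three edge-disjoint paths. Logarithms are base 2. *)

theory Defs
  imports Complex_Main
begin

definition packing :: "'a set set \<Rightarrow> 'a set set \<Rightarrow> bool" where
  "packing \<X> \<A> \<longleftrightarrow> \<A> \<subseteq> \<X> \<and> pairwise disjnt \<A>"

definition conflicting :: "'a set set \<Rightarrow> 'a set \<Rightarrow> 'a set set" where
  "conflicting \<A> Y = {S \<in> \<A>. \<not> disjnt S Y}"

text \<open>Undirected multigraphs: \<open>ends\<close> gives the set of end-vertices of an edge, a two-element set
  for an ordinary edge and a singleton for a loop. Distinct edges may have the same ends.\<close>

record ('v, 'e) multigraph =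
  verts :: "'v set"
  edges :: "'e set"
  ends :: "'e \<Rightarrow> 'v set"

definition edge_subgraph :: "('v, 'e) multigraph \<Rightarrow> 'e set \<Rightarrow> ('v, 'e) multigraph" where
  "edge_subgraph G I = \<lparr>verts = (\<Union>e\<in>I. ends G e), edges = I, ends = ends G\<rparr>"

definition walk :: "('v, 'e) multigraph \<Rightarrow> 'v list \<Rightarrow> 'e list \<Rightarrow> bool" where
  "walk G vs es \<longleftrightarrow>
     set vs \<subseteq> verts G \<and> set es \<subseteq> edges G \<and> length vs = Suc (length es) \<and>
     (\<forall>i<length es. ends G (es ! i) = {vs ! i, vs ! Suc i})"

definition simple_path :: "('v, 'e) multigraph \<Rightarrow> 'v list \<Rightarrow> 'e list \<Rightarrow> bool" where
  "simple_path G vs es \<longleftrightarrow> walk G vs es \<and> distinct vs"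

text \<open>The first vertex is repeated at the end of \<open>vs\<close>, so a loop is a cycle of length 1. The
  condition \<open>distinct es\<close> matters only for length 2: it demands two different parallel edges.\<close>

definition cycle :: "('v, 'e) multigraph \<Rightarrow> 'v list \<Rightarrow> 'e list \<Rightarrow> bool" where
  "cycle G vs es \<longleftrightarrow>
     walk G vs es \<and> es \<noteq> [] \<and> hd vs = last vs \<and> distinct (tl vs) \<and> distinct es"

definition graph_connected :: "('v, 'e) multigraph \<Rightarrow> bool" where
  "graph_connected G \<longleftrightarrow> verts G \<noteq> {} \<and>
     (\<forall>u\<in>verts G. \<forall>v\<in>verts G. \<exists>vs es. walk G vs es \<and> hd vs = u \<and> last vs = v)"

text \<open>Cycles are compared as subgraphs, i.e. by their edge sets, so that rotations and reversals
  of the same cycle are not counted as distinct.\<close>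

definition two_distinct_cycles :: "('v, 'e) multigraph \<Rightarrow> bool" where
  "two_distinct_cycles G \<longleftrightarrow>
     (\<exists>vs es vs' es'. cycle G vs es \<and> cycle G vs' es' \<and> set es \<noteq> set es')"

text \<open>The joining path meets each of the cycles in exactly one of its end-vertices.\<close>

definition cycles_joined_by_path :: "('v, 'e) multigraph \<Rightarrow> bool" where
  "cycles_joined_by_path G \<longleftrightarrow>
     (\<exists>vs1 es1 vs2 es2 ps qs.
        cycle G vs1 es1 \<and> cycle G vs2 es2 \<and> set es1 \<inter> set es2 = {} \<and>
        simple_path G ps qs \<and> qs \<noteq> [] \<and>
        set ps \<inter> set vs1 = {hd ps} \<and> set ps \<inter> set vs2 = {last ps} \<and>
        edges G = set es1 \<union> set es2 \<union> set qs)"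

definition cycles_sharing_vertex :: "('v, 'e) multigraph \<Rightarrow> bool" where
  "cycles_sharing_vertex G \<longleftrightarrow>
     (\<exists>vs1 es1 vs2 es2 v.
        cycle G vs1 es1 \<and> cycle G vs2 es2 \<and> set es1 \<inter> set es2 = {} \<and>
        set vs1 \<inter> set vs2 = {v} \<and>
        edges G = set es1 \<union> set es2)"

definition vertices_joined_by_three_paths :: "('v, 'e) multigraph \<Rightarrow> bool" where
  "vertices_joined_by_three_paths G \<longleftrightarrow>
     (\<exists>u v ps1 qs1 ps2 qs2 ps3 qs3. u \<noteq> v \<and>
        simple_path G ps1 qs1 \<and> hd ps1 = u \<and> last ps1 = v \<and>
        simple_path G ps2 qs2 \<and> hd ps2 = u \<and> last ps2 = v \<and>
        simple_path G ps3 qs3 \<and> hd ps3 = u \<and> last ps3 = v \<and>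
        set qs1 \<inter> set qs2 = {} \<and> set qs1 \<inter> set qs3 = {} \<and> set qs2 \<inter> set qs3 = {} \<and>
        edges G = set qs1 \<union> set qs2 \<union> set qs3)"

text \<open>An edge of the auxiliary multigraph is the set of \<open>\<X>\<close> that it corresponds to.\<close>

definition aux_graph :: "'a set set \<Rightarrow> 'a set set \<Rightarrow> ('a set, 'a set) multigraph" where
  "aux_graph \<X> \<A> =
     \<lparr>verts = \<A>,
      edges = \<A> \<union> {Y \<in> \<X> - \<A>. card (conflicting \<A> Y) = 1 \<or> card (conflicting \<A> Y) = 2},
      ends = (\<lambda>Y. if Y \<in> \<A> then {Y} else conflicting \<A> Y)\<rparr>"

definition improvement :: "'a set set \<Rightarrow> 'a set set \<Rightarrow> nat \<Rightarrow> 'a set set \<Rightarrow> bool" where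
  "improvement \<X> \<A> t I \<longleftrightarrow>
     I \<subseteq> edges (aux_graph \<X> \<A>) \<and> finite I \<and> card I = t \<and>
     card (\<Union>Y\<in>I. ends (aux_graph \<X> \<A>) Y) + 1 \<le> t \<and>
     pairwise disjnt I"

definition canonical :: "'a set set \<Rightarrow> 'a set set \<Rightarrow> 'a set set \<Rightarrow> bool" where
  "canonical \<X> \<A> I \<longleftrightarrow>
     (let H = edge_subgraph (aux_graph \<X> \<A>) I in
        graph_connected H \<and> two_distinct_cycles H \<and>
        (cycles_joined_by_path H \<or> cycles_sharing_vertex H \<or> vertices_joined_by_three_paths H))"

end

theory Submission
  imports Defs
begin

text \<open>Call \<open>A1\<close> the members of \<open>\<A>\<close> carrying a loop from \<open>\<B>\<close>, \<open>A2\<close> the others, and let \<open>B1\<close>, \<open>B2\<close>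
  be the sets of \<open>\<B>\<close> with one, respectively two, conflicts. Double counting conflicts gives
  \<open>3|\<B>| \<le> k|\<A>| + 2|B1| + |B2|\<close>, so it suffices that \<open>|B1| = |A1|\<close> and \<open>|B2| \<le> 2|A2|\<close>.

  Any edge set from \<open>\<B>\<close> with more edges than covered vertices contains a canonical improvement, so
  no small such set exists. If \<open>|B2| > 2|A2|\<close>, delete the vertices in \<open>A1\<close> from the ends of the
  edges in \<open>B2\<close>, which turns edges between \<open>A1\<close> and \<open>A2\<close> into loops. Some induced subgraph has all
  degrees at least 3, and as long as a breadth-first search there meets at most one non-tree edge,
  its balls double in size. Hence two non-tree edges appear at logarithmic depth; with their tree
  paths, and with the loops at the at most two vertices of \<open>A1\<close> involved, they form a small edge set
  with more edges than vertices.\<close>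

section \<open>Walks\<close>

text \<open>Walks described by the end function alone, without the membership conditions of
  \<open>walk\<close>, so that one walk can be read in several edge subgraphs.\<close>

fun links :: "('e \<Rightarrow> 'v set) \<Rightarrow> 'v list \<Rightarrow> 'e list \<Rightarrow> bool" where
  "links f [v] [] \<longleftrightarrow> True"
| "links f (u # v # vs) (e # es) \<longleftrightarrow> f e = {u, v} \<and> links f (v # vs) es"
| "links f _ _ \<longleftrightarrow> False"

lemma links_iff_nth:
  "links f vs es \<longleftrightarrow>
     length vs = Suc (length es) \<and> (\<forall>i<length es. f (es ! i) = {vs ! i, vs ! Suc i})"
  by (induction f vs es rule: links.induct) (auto simp: All_less_Suc2)

lemma walk_edge_subgraph_iff:
  "walk (edge_subgraph G I) vs es \<longleftrightarrow>
     links (ends G) vs es \<and> set es \<subseteq> I \<and> set vs \<subseteq> (\<Union>e\<in>I. ends G e)"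
  unfolding walk_def edge_subgraph_def links_iff_nth by auto

lemma links_length: "links f vs es \<Longrightarrow> length vs = Suc (length es)"
  by (simp add: links_iff_nth)

text \<open>As an equivalence this serves both to cut a walk at a vertex and to glue two walks
  there.\<close>

lemma links_append:
  "links f (as @ x # bs) es \<longleftrightarrow>
     (\<exists>es1 es2. es = es1 @ es2 \<and> links f (as @ [x]) es1 \<and> links f (x # bs) es2)"
proof (induction as arbitrary: es)
  case Nil
  show ?case
  proof
    assume "links f ([] @ x # bs) es"
    then show "\<exists>es1 es2. es = es1 @ es2 \<and> links f ([] @ [x]) es1 \<and> links f (x # bs) es2"
      by (intro exI[of _ "[]"] exI[of _ es]) auto
  next
    assume "\<exists>es1 es2. es = es1 @ es2 \<and> links f ([] @ [x]) es1 \<and> links f (x # bs) es2"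
    then obtain es1 es2 where "es = es1 @ es2" "links f [x] es1" "links f (x # bs) es2" by auto
    moreover from this have "es1 = []" by (cases es1) auto
    ultimately show "links f ([] @ x # bs) es" by simp
  qed
next
  case (Cons a as)
  obtain y ys zs where y: "as @ x # bs = y # ys" "as @ [x] = y # zs"
    by (cases as) auto
  show ?case
  proof (cases es)
    case Nil
    then show ?thesis using y by auto
  next
    case (Cons e es')
    have "(\<exists>es1 es2. es = es1 @ es2 \<and> links f (a # y # zs) es1 \<and> links f (x # bs) es2) \<longleftrightarrow>
      f e = {a, y} \<and> (\<exists>es1 es2. es' = es1 @ es2 \<and> links f (y # zs) es1 \<and> links f (x # bs) es2)"
    proof
      assume "\<exists>es1 es2. es = es1 @ es2 \<and> links f (a # y # zs) es1 \<and> links f (x # bs) es2"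
      then obtain es1 es2 where 1: "es = es1 @ es2" "links f (a # y # zs) es1" "links f (x # bs) es2"
        by auto
      then obtain es1' where "es1 = e # es1'" using Cons by (cases es1) auto
      then show "f e = {a, y} \<and>
        (\<exists>es1 es2. es' = es1 @ es2 \<and> links f (y # zs) es1 \<and> links f (x # bs) es2)"
        using 1 Cons by auto
    next
      assume "f e = {a, y} \<and>
        (\<exists>es1 es2. es' = es1 @ es2 \<and> links f (y # zs) es1 \<and> links f (x # bs) es2)"
      then obtain es1 es2 where
        "f e = {a, y}" "es' = es1 @ es2" "links f (y # zs) es1" "links f (x # bs) es2" by auto
      then show "\<exists>es1 es2. es = es1 @ es2 \<and> links f (a # y # zs) es1 \<and> links f (x # bs) es2"
        using Cons by (intro exI[of _ "e # es1"] exI[of _ es2]) auto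
    qed
    then show ?thesis using Cons.IH[of es'] y Cons by auto
  qed
qed

lemma links_rev: "links f vs es \<Longrightarrow> links f (rev vs) (rev es)"
proof (induction f vs es rule: links.induct)
  case (2 f u v vs e es)
  then have "links f (rev vs @ [v]) (rev es)" "links f [v, u] [e]"
    by (auto simp: insert_commute)
  then show ?case using links_append[of f "rev vs" v "[u]" "rev es @ [e]"]
    by (metis append.assoc append_Cons append_Nil rev.simps(2))
qed auto

lemma links_set:
  "links f vs es \<Longrightarrow> es \<noteq> [] \<Longrightarrow> (\<Union>e\<in>set es. f e) = set vs"
proof (induction f vs es rule: links.induct)
  case (2 f u v vs e es)
  then show ?case by (cases "es = []"; cases vs) auto
qed auto

lemma links_subset: "links f vs es \<Longrightarrow> e \<in> set es \<Longrightarrow> f e \<subseteq> set vs"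
  using links_set by (metis UN_upper empty_iff empty_set)

text \<open>Follow the walk backwards from \<open>u\<close> to its first vertex, then forwards to
  \<open>v\<close>.\<close>

lemma links_reach:
  assumes "links f vs es" "u \<in> set vs" "v \<in> set vs"
  obtains ws fs where "links f ws fs" "hd ws = u" "last ws = v" "set fs \<subseteq> set es"
    "set ws \<subseteq> set vs"
proof -
  have prefix: "\<exists>ws fs. links f ws fs \<and> hd ws = hd vs \<and> last ws = x \<and> set fs \<subseteq> set es \<and>
      set ws \<subseteq> set vs" if x: "x \<in> set vs" for x
  proof -
    obtain as bs where "vs = as @ x # bs" using x by (meson split_list)
    then obtain es1 es2 where "es = es1 @ es2" "links f (as @ [x]) es1"
      using assms(1) links_append by metis
    then show ?thesis using \<open>vs = _\<close>
      by (intro exI[of _ "as @ [x]"] exI[of _ es1]) (auto simp: hd_append)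
  qed
  obtain ws1 fs1 where 1: "links f ws1 fs1" "hd ws1 = hd vs" "last ws1 = u" "set fs1 \<subseteq> set es"
    "set ws1 \<subseteq> set vs" using prefix assms(2) by blast
  obtain ws2 fs2 where 2: "links f ws2 fs2" "hd ws2 = hd vs" "last ws2 = v" "set fs2 \<subseteq> set es"
    "set ws2 \<subseteq> set vs" using prefix assms(3) by blast
  have ne: "ws1 \<noteq> []" "ws2 \<noteq> []" using links_length[OF 1(1)] links_length[OF 2(1)] by auto
  have r: "links f (rev ws1) (rev fs1)" by (rule links_rev[OF 1(1)])
  obtain x ws1' where x: "ws1 = x # ws1'" using ne by (cases ws1) auto
  obtain ws2' where x2: "ws2 = x # ws2'" using ne 1(2) 2(2) x by (cases ws2) auto
  have "links f (rev ws1' @ x # ws2') (rev fs1 @ fs2)"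
    using r 2(1) x x2 links_append[of f "rev ws1'" x ws2' "rev fs1 @ fs2"] by auto
  moreover have "hd (rev ws1' @ x # ws2') = u" "last (rev ws1' @ x # ws2') = v"
    using 1(3) 2(3) x x2 by (auto simp: hd_append hd_rev)
  ultimately show ?thesis using that[of "rev ws1' @ x # ws2'" "rev fs1 @ fs2"] 1 2 x x2 by auto
qed

text \<open>\<open>W\<close> holds vertices counted as visited in advance, \<open>F\<close> edges
  that may not be used. A vertex met for the first time has a second edge by \<open>deg\<close>, and
  that edge is fresh, so the walk can go on; finiteness of \<open>J\<close> makes it stop.\<close>

lemma walk_until_visited:
  fixes f :: "'e \<Rightarrow> 'v set"
  assumes fin: "finite J"
    and two: "\<forall>e\<in>J. \<exists>u v. f e = {u, v}"
    and deg: "\<And>v e. e \<in> J \<Longrightarrow> v \<in> f e \<Longrightarrow> \<exists>e'\<in>J. e' \<noteq> e \<and> v \<in> f e'"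
    and F: "\<And>e. e \<in> F \<Longrightarrow> f e \<subseteq> W"
    and "v0 \<in> W" "e0 \<in> J" "e0 \<notin> F" "v0 \<in> f e0"
  obtains vs es x where "links f (v0 # vs @ [x]) es" "distinct es" "set es \<subseteq> J - F"
    "distinct (v0 # vs)" "set vs \<inter> W = {}" "x \<in> W \<union> set vs"
proof -
  have "\<exists>vs es x. links f (v0 # vs @ [x]) es \<and> distinct es \<and> set es \<subseteq> J - F \<and>
      distinct (v0 # vs) \<and> set vs \<inter> W = {} \<and> x \<in> W \<union> set vs"
    if "links f (v0 # vs) es" "distinct es" "set es \<subseteq> J - F" "distinct (v0 # vs)"
      "set vs \<inter> W = {}" "e \<in> J - F - set es" "last (v0 # vs) \<in> f e" for vs es e
    using that
  proof (induction "card J - length es" arbitrary: vs es e rule: less_induct)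
    case less
    have "e \<in> J" using less.prems(6) by simp
    then obtain a b where "f e = {a, b}" using two by blast
    then obtain x where x: "f e = {last (v0 # vs), x}"
      using less.prems(7) by (metis insert_commute insert_iff singletonD)
    have "links f (v0 # vs @ [x]) (es @ [e])"
    proof -
      have "links f [last (v0 # vs), x] [e]" using x by simp
      moreover have sp: "butlast (v0 # vs) @ [last (v0 # vs)] = v0 # vs"
        by (rule append_butlast_last_id) simp
      ultimately have "links f (butlast (v0 # vs) @ last (v0 # vs) # [x]) (es @ [e])"
        using less.prems(1) unfolding links_append sp by blast
      moreover have "butlast (v0 # vs) @ last (v0 # vs) # [x] = v0 # vs @ [x]"
        using sp by (metis append.assoc append_Cons append_Nil)
      ultimately show ?thesis by (simp only:)
    qed
    note ext = this
    show ?case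
    proof (cases "x \<in> W \<union> set vs")
      case True
      show ?thesis
        using ext less.prems True by (intro exI[of _ vs] exI[of _ "es @ [e]"] exI[of _ x]) auto
    next
      case False
      obtain e' where e': "e' \<in> J" "e' \<noteq> e" "x \<in> f e'" using deg[of e x] x less.prems(6) by auto
      \<comment> \<open>Edges of \<open>F\<close> and of the walk so far have all their ends in
        \<open>W \<union> set vs\<close>, where \<open>x\<close> does not lie.\<close>
      have "e' \<notin> F" using F e'(3) False by auto
      have "e' \<notin> set es"
        using links_subset[OF less.prems(1)] e'(3) False \<open>v0 \<in> W\<close> by auto
      have "length es < card J"
      proof -
        have "set (es @ [e]) \<subseteq> J" using less.prems by auto
        then have "card (set (es @ [e])) \<le> card J" using fin card_mono by blast
        moreover have "distinct (es @ [e])" using less.prems by auto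
        ultimately show ?thesis using distinct_card by fastforce
      qed
      then have "card J - length (es @ [e]) < card J - length es" by simp
      from less.hyps[OF this, of "vs @ [x]" e'] show ?thesis
        using ext less.prems e' \<open>e' \<notin> F\<close> \<open>e' \<notin> set es\<close> False \<open>v0 \<in> W\<close> by auto
    qed
  qed
  from this[of "[]" "[]" e0] show ?thesis using assms that by auto
qed

text \<open>The vertex condition of \<open>walk\<close> disappears because all vertices of a
  nonempty walk are ends of its edges.\<close>

lemma cycle_edge_subgraph_iff:
  "cycle (edge_subgraph G I) (v # vs) es \<longleftrightarrow>
     links (ends G) (v # vs) es \<and> set es \<subseteq> I \<and> es \<noteq> [] \<and> last (v # vs) = v \<and>
     distinct vs \<and> distinct es"
  unfolding cycle_def walk_edge_subgraph_iff using links_set by fastforce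

lemma simple_path_edge_subgraph_iff:
  assumes "es \<noteq> []"
  shows "simple_path (edge_subgraph G I) vs es \<longleftrightarrow>
     links (ends G) vs es \<and> set es \<subseteq> I \<and> distinct vs"
  unfolding simple_path_def walk_edge_subgraph_iff using links_set assms by fastforce

text \<open>The walk runs through every edge, hence through every covered vertex, and any two of its
  vertices are joined along it.\<close>

lemma graph_connected_edge_subgraph:
  assumes "links (ends G) vs es" "es \<noteq> []"
  shows "graph_connected (edge_subgraph G (set es))"
proof -
  have s: "verts (edge_subgraph G (set es)) = set vs"
    using links_set[OF assms] by (simp add: edge_subgraph_def)
  have "\<exists>ws fs. walk (edge_subgraph G (set es)) ws fs \<and> hd ws = u \<and> last ws = v"
    if uv: "u \<in> set vs" "v \<in> set vs" for u v
    using links_reach[OF assms(1) uv] links_set[OF assms] walk_edge_subgraph_iff by metis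
  then show ?thesis
    unfolding graph_connected_def s using links_length[OF assms(1)] by auto
qed

lemma edges_edge_subgraph [simp]: "edges (edge_subgraph G I) = I"
  by (simp add: edge_subgraph_def)

text \<open>The walk is cut at \<open>v\<close> and its second piece put before the first, glued at
  \<open>x\<close>. The vertex sets agree because the base point of a closed walk recurs in the
  tail.\<close>

lemma rotate_closed_walk:
  assumes "links f (x # bs) es" "last (x # bs) = x" "es \<noteq> []" "distinct bs" "distinct es"
    "v \<in> set bs"
  obtains cs fs where "links f (v # cs) fs" "last (v # cs) = v" "fs \<noteq> []" "distinct cs"
    "distinct fs" "set cs = set bs" "set fs = set es"
proof -
  obtain b1 b2 where b: "bs = b1 @ v # b2" using assms(6) by (meson split_list)
  obtain ea eb where e: "es = ea @ eb" "links f (x # b1 @ [v]) ea" "links f (v # b2) eb"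
    using assms(1) links_append[of f "x # b1" v b2 es] b by auto
  have l: "last (v # b2) = x" using assms(2) b by auto
  then have sp: "v # b2 = butlast (v # b2) @ [x]"
    by (metis append_butlast_last_id list.distinct(1))
  then have "links f (butlast (v # b2) @ x # (b1 @ [v])) (eb @ ea)"
    using e links_append[of f "butlast (v # b2)" x "b1 @ [v]" "eb @ ea"] by metis
  then have "links f ((butlast (v # b2) @ [x]) @ b1 @ [v]) (eb @ ea)" by simp
  then have "links f (v # (b2 @ b1 @ [v])) (eb @ ea)" unfolding sp[symmetric] by simp
  then show ?thesis
    by (rule that) (use assms b e in auto)
qed

section \<open>Canonical subgraphs\<close>

text \<open>The conditions of \<open>canonical\<close> for an arbitrary multigraph, so that the
  graph arguments need no set packing.\<close>

definition bicyclic :: "('v, 'e) multigraph \<Rightarrow> bool" where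
  "bicyclic H \<longleftrightarrow> graph_connected H \<and> two_distinct_cycles H \<and>
     (cycles_joined_by_path H \<or> cycles_sharing_vertex H \<or> vertices_joined_by_three_paths H)"

text \<open>The walk leaves the cycle at \<open>v\<close> and stops at its first repeated vertex \<open>x\<close>. The three shapes
  arise as \<open>x = v\<close>, as another vertex of the cycle, or as an inner vertex of the walk.\<close>

lemma bicyclic_cycle_with_ear:
  assumes c: "links (ends G) (v # cs) fs" "last (v # cs) = v" "fs \<noteq> []" "distinct cs" "distinct fs"
    and p: "links (ends G) (v # vs @ [x]) es" "distinct es" "set es \<inter> set fs = {}"
    and d: "distinct (v # vs)" "set vs \<inter> set cs = {}" "x \<in> set cs \<union> set vs"
  shows "bicyclic (edge_subgraph G (set fs \<union> set es))" (is "bicyclic ?H")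
proof -
  have csne: "cs \<noteq> []" using links_length[OF c(1)] c(3) by auto
  then have vcs: "v \<in> set cs" using c(2) last_in_set by fastforce
  have esne: "es \<noteq> []" using links_length[OF p(1)] by auto
  have conn: "graph_connected ?H"
  proof -
    \<comment> \<open>Once around the cycle and then along the ear is a single walk using every
      edge.\<close>
    have sp: "v # cs = butlast (v # cs) @ [v]"
      using c(2) by (metis append_butlast_last_id list.distinct(1))
    have "links (ends G) (butlast (v # cs) @ v # (vs @ [x])) (fs @ es)"
      using c(1) p(1) sp links_append[of "ends G" "butlast (v # cs)" v "vs @ [x]" "fs @ es"] by metis
    from graph_connected_edge_subgraph[OF this] show ?thesis using c(3) by simp
  qed
  have cyc: "cycle ?H (v # cs) fs" using c by (simp add: cycle_edge_subgraph_iff)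
  consider "x = v" | "x \<in> set cs" "x \<noteq> v" | "x \<in> set vs" using d by auto
  then show ?thesis
  proof cases
    case 1
    have cyc2: "cycle ?H (v # vs @ [v]) es"
      using p d 1 esne vcs by (auto simp: cycle_edge_subgraph_iff)
    have "two_distinct_cycles ?H"
      unfolding two_distinct_cycles_def
      using cyc cyc2 p(3) esne by (metis inf.idem set_empty)
    moreover have "cycles_sharing_vertex ?H"
      unfolding cycles_sharing_vertex_def
      by (intro exI[of _ "v # cs"] exI[of _ fs] exI[of _ "v # vs @ [v]"] exI[of _ es] exI[of _ v])
        (use cyc cyc2 p d vcs in auto)
    ultimately show ?thesis using conn by (simp add: bicyclic_def)
  next
    case 2
    obtain c1 c2 where cc: "cs = c1 @ x # c2" using 2 by (meson split_list)
    obtain f1 f2 where f: "fs = f1 @ f2" "links (ends G) (v # c1 @ [x]) f1"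
        "links (ends G) (x # c2) f2"
      using c(1) links_append[of "ends G" "v # c1" x c2 fs] cc by auto
    have l2: "last (x # c2) = v" using c(2) cc by auto
    then have c2ne: "c2 \<noteq> []" and vc2: "v \<in> set c2" using 2
      by (auto split: if_splits dest: last_in_set)
    have fne: "f1 \<noteq> []" "f2 \<noteq> []"
      using links_length[OF f(2)] links_length[OF f(3)] c2ne by auto
    \<comment> \<open>The second cycle closes the ear with the arc \<open>f2\<close> from
      \<open>x\<close> back to \<open>v\<close>.\<close>
    have cyc2: "cycle ?H (v # (vs @ x # c2)) (es @ f2)"
      unfolding cycle_edge_subgraph_iff
    proof (intro conjI)
      show "links (ends G) (v # (vs @ x # c2)) (es @ f2)"
        using p(1) f(3) links_append[of "ends G" "v # vs" x c2 "es @ f2"] by auto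
      show "last (v # vs @ x # c2) = v" using l2 by simp
      show "distinct (vs @ x # c2)" using c(4) d cc by auto
    qed (use p c f esne in auto)
    have "two_distinct_cycles ?H"
    proof -
      have "set fs \<noteq> set (es @ f2)" using p(3) esne by (metis Int_iff Un_iff empty_iff
        last_in_set set_append)
      then show ?thesis unfolding two_distinct_cycles_def using cyc cyc2 by metis
    qed
    \<comment> \<open>The three paths from \<open>v\<close> to \<open>x\<close> are the arc
      \<open>f1\<close>, the arc \<open>f2\<close> reversed, and the ear.\<close>
    moreover have "vertices_joined_by_three_paths ?H"
      unfolding vertices_joined_by_three_paths_def
    proof (intro exI conjI)
      show "v \<noteq> x" using 2 by simp
      show "simple_path ?H (v # c1 @ [x]) f1"
        using f c cc vc2 fne 2 by (auto simp: simple_path_edge_subgraph_iff)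
      show "simple_path ?H (rev (x # c2)) (rev f2)"
        using f c cc vc2 fne 2 links_rev[OF f(3)] by (auto simp: simple_path_edge_subgraph_iff)
      show "simple_path ?H (v # vs @ [x]) es"
        using p d esne 2 by (auto simp: simple_path_edge_subgraph_iff)
      show "hd (rev (x # c2)) = v" using l2 hd_rev by metis
    qed (use f c p in auto)
    ultimately show ?thesis using conn by (simp add: bicyclic_def)
  next
    case 3
    \<comment> \<open>The walk up to its first visit of \<open>x\<close> is the joining path; the
      rest, from \<open>x\<close> back to \<open>x\<close>, is the second cycle.\<close>
    obtain a b where ab: "vs = a @ x # b" using 3 by (meson split_list)
    obtain e1 e2 where e: "es = e1 @ e2" "links (ends G) (v # a @ [x]) e1"
        "links (ends G) (x # b @ [x]) e2"
      using p(1) links_append[of "ends G" "v # a" x "b @ [x]" es] ab by auto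
    have ne: "e1 \<noteq> []" "e2 \<noteq> []" using links_length[OF e(2)] links_length[OF e(3)] by auto
    have cyc2: "cycle ?H (x # b @ [x]) e2"
      using e p d ab ne by (auto simp: cycle_edge_subgraph_iff)
    have "two_distinct_cycles ?H"
    proof -
      have "set fs \<noteq> set e2" using p(3) ne e(1) by (metis Int_iff Un_iff empty_iff
        last_in_set set_append)
      then show ?thesis unfolding two_distinct_cycles_def using cyc cyc2 by metis
    qed
    moreover have "cycles_joined_by_path ?H"
      unfolding cycles_joined_by_path_def
    proof (intro exI conjI)
      show "cycle ?H (v # cs) fs" "cycle ?H (x # b @ [x]) e2" by fact+
      show "simple_path ?H (v # a @ [x]) e1"
        using e p d ab ne by (auto simp: simple_path_edge_subgraph_iff)
      show "set (v # a @ [x]) \<inter> set (v # cs) = {hd (v # a @ [x])}" using ab d vcs by auto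
      show "set (v # a @ [x]) \<inter> set (x # b @ [x]) = {last (v # a @ [x])}" using ab d by auto
    qed (use e p ne in auto)
    ultimately show ?thesis using conn by (simp add: bicyclic_def)
  qed
qed

lemma exists_bicyclic_edge_subset:
  fixes G :: "('v, 'e) multigraph"
  assumes "finite J0"
    and "\<forall>e\<in>J0. \<exists>u v. ends G e = {u, v}"
    and "card (\<Union>e\<in>J0. ends G e) < card J0"
  obtains I where "I \<subseteq> J0" "card (\<Union>e\<in>I. ends G e) < card I" "bicyclic (edge_subgraph G I)"
proof -
  let ?V = "\<lambda>J. \<Union>e\<in>J. ends G e"
  \<comment> \<open>In a minimal set \<open>J\<close> every covered vertex is on two edges and no cycle is isolated, so a walk
    closes up to a cycle and a second walk leaving that cycle closes up as well.\<close>
  obtain J where J: "J \<subseteq> J0" "card (?V J) < card J"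
    and min: "\<And>J'. J' \<subseteq> J0 \<Longrightarrow> card (?V J') < card J' \<Longrightarrow> card J \<le> card J'"
    using ex_has_least_nat[of "\<lambda>J. J \<subseteq> J0 \<and> card (?V J) < card J" J0 card] assms(3) by auto
  have fin: "finite J" using J(1) assms(1) finite_subset by blast
  have two: "\<forall>e\<in>J. \<exists>u v. ends G e = {u, v}" using assms(2) J(1) by blast
  have finV: "finite (?V J)" using fin two by (metis finite.simps finite_UN)
  \<comment> \<open>Otherwise dropping \<open>e\<close> would also uncover \<open>v\<close>, and the
    surplus of edges would survive in a smaller set.\<close>
  have deg: "\<exists>e'\<in>J. e' \<noteq> e \<and> v \<in> ends G e'" if "e \<in> J" "v \<in> ends G e" for v e
  proof (rule ccontr)
    assume "\<not> ?thesis"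
    then have "?V (J - {e}) \<subseteq> ?V J - {v}" by auto
    then have "card (?V (J - {e})) \<le> card (?V J - {v})" using finV by (simp add: card_mono)
    also have "\<dots> < card (?V J)" using that finV by (intro card_Diff1_less) auto
    also have "\<dots> \<le> card (J - {e})" using J(2) fin that by simp
    finally have "card J \<le> card (J - {e})" using min J(1) by blast
    then show False using card_Diff1_less[OF fin that(1)] by simp
  qed
  obtain e0 where e0: "e0 \<in> J" using J(2) by fastforce
  then obtain v0 where v0: "v0 \<in> ends G e0" using two by blast
  obtain vs es x where l: "links (ends G) (v0 # vs @ [x]) es" "distinct es" "set es \<subseteq> J"
    "distinct (v0 # vs)" "x \<in> set (v0 # vs)"
  proof (rule walk_until_visited[of J "ends G" "{}" "{v0}" v0 e0, OF fin two deg])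
  qed (use e0 v0 in auto)
  obtain a b where ab: "v0 # vs = a @ x # b" using l(5) by (meson split_list)
  have "links (ends G) (a @ x # (b @ [x])) es" using l(1) ab
    by (metis append.assoc append_Cons)
  then obtain e1 e2 where e: "es = e1 @ e2" "links (ends G) (x # b @ [x]) e2"
    using links_append by metis
  have e2ne: "e2 \<noteq> []" using links_length[OF e(2)] by auto
  have db: "distinct (b @ [x])" using l(4) ab by auto
  have C: "card (set e2) = card (set (b @ [x]))"
    using links_length[OF e(2)] db e(1) l(2) by (simp add: distinct_card)
  have VC: "?V (set e2) = set (b @ [x])" using links_set[OF e(2) e2ne] by auto
  have e2J: "set e2 \<subseteq> J" using e(1) l(3) by auto
  then have VCJ: "set (b @ [x]) \<subseteq> ?V J" unfolding VC[symmetric] by blast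
  \<comment> \<open>The cycle has as many edges as vertices, so if no other edge met it, dropping it
    would leave a smaller set with a surplus.\<close>
  have "\<exists>e\<in>J - set e2. ends G e \<inter> set (b @ [x]) \<noteq> {}"
  proof (rule ccontr)
    assume "\<not> ?thesis"
    then have "?V (J - set e2) \<subseteq> ?V J - set (b @ [x])" by auto
    then have "card (?V (J - set e2)) \<le> card (?V J - set (b @ [x]))"
      using finV by (simp add: card_mono)
    also have "\<dots> = card (?V J) - card (set (b @ [x]))"
      using VCJ by (intro card_Diff_subset) auto
    also have "\<dots> < card J - card (set e2)"
      using J(2) C card_mono[OF finV VCJ] by linarith
    also have "\<dots> = card (J - set e2)" using e2J by (simp add: card_Diff_subset)
    finally have "card J \<le> card (J - set e2)" using min J(1) by blast
    moreover have "card (J - set e2) < card J"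
      using e2J e2ne fin by (intro psubset_card_mono) (auto simp: neq_Nil_conv)
    ultimately show False by simp
  qed
  then obtain g v where g: "g \<in> J" "g \<notin> set e2" "v \<in> ends G g" "v \<in> set (b @ [x])" by blast
  obtain cs fs where c: "links (ends G) (v # cs) fs" "last (v # cs) = v" "fs \<noteq> []" "distinct cs"
    "distinct fs" "set cs = set (b @ [x])" "set fs = set e2"
    using rotate_closed_walk[OF e(2) _ e2ne db _ g(4)] e(1) l(2) by auto
  obtain ws hs y where h: "links (ends G) (v # ws @ [y]) hs" "distinct hs"
    "set hs \<subseteq> J - set fs" "distinct (v # ws)" "set ws \<inter> set cs = {}" "y \<in> set cs \<union> set ws"
  proof (rule walk_until_visited[of J "ends G" "set fs" "set cs" v g, OF fin two deg])
    show "ends G e \<subseteq> set cs" if "e \<in> set fs" for e using VC c(6,7) that by auto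
  qed (use g c in auto)
  let ?I = "set fs \<union> set hs"
  have "bicyclic (edge_subgraph G ?I)"
    using bicyclic_cycle_with_ear[OF c(1-5) h(1,2)] h by auto
  moreover have "card (?V ?I) < card ?I"
  proof -
    have hne: "hs \<noteq> []" using links_length[OF h(1)] by auto
    have "?V ?I = set cs \<union> set ws"
      using links_set[OF h(1) hne] VC c(6,7) g(4) h(6) by auto
    then have "card (?V ?I) \<le> card (set cs) + card (set ws)" by (simp add: card_Un_le)
    \<comment> \<open>The walk \<open>hs\<close> has one edge more than \<open>ws\<close> has
      vertices, while the cycle is balanced.\<close>
    also have "\<dots> < card (set fs) + card (set hs)"
      using C c(6,7) links_length[OF h(1)] h(2,4) by (simp add: distinct_card)
    also have "\<dots> = card ?I" using h(3) by (intro card_Un_disjoint[symmetric]) auto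
    finally show ?thesis .
  qed
  moreover have "?I \<subseteq> J0" using c(7) e2J h(3) J(1) by auto
  ultimately show ?thesis using that by blast
qed

section \<open>Small subgraphs with more edges than vertices\<close>

text \<open>If there were no such set, the balls around \<open>r\<close> would double in each of
  \<open>d\<close> steps and outgrow \<open>V\<close>. At most two chosen edges are loops, which
  limits how many loops at deleted vertices must be added back later.\<close>

lemma small_dense_edge_set:
  fixes f :: "'e \<Rightarrow> 'v set"
  assumes finV: "finite V" and "V \<noteq> {}" and finE: "finite E"
    and fE: "\<And>e. e \<in> E \<Longrightarrow> f e \<subseteq> V"
    and two: "\<And>e. e \<in> E \<Longrightarrow> \<exists>u v. f e = {u, v}"
    and deg: "\<And>v. v \<in> V \<Longrightarrow> 3 \<le> card {e \<in> E. v \<in> f e}"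
    and d: "card V < 2 ^ d"
  obtains I where "I \<subseteq> E" "card (\<Union>e\<in>I. f e) < card I" "card I \<le> 4 * d"
    "card {e \<in> I. card (f e) = 1} \<le> 2"
proof (rule ccontr)
  assume "\<not> thesis"
  with that have none: "card I \<le> card (\<Union>e\<in>I. f e)"
    if "I \<subseteq> E" "card I \<le> 4 * d" "card {e \<in> I. card (f e) = 1} \<le> 2" for I
    using that leI by blast
  obtain r where r: "r \<in> V" using \<open>V \<noteq> {}\<close> by blast
  define ball where "ball = rec_nat {r} (\<lambda>_ S. S \<union> \<Union>(f ` {e \<in> E. f e \<inter> S \<noteq> {}}))"
  have ball_0: "ball 0 = {r}" and ball_Suc:
    "\<And>n. ball (Suc n) = ball n \<union> \<Union>(f ` {e \<in> E. f e \<inter> ball n \<noteq> {}})"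
    by (simp_all add: ball_def)
  have ball_V: "ball n \<subseteq> V" for n
    by (induction n) (use r fE in \<open>auto simp: ball_0 ball_Suc\<close>)
  then have fin_ball: "finite (ball n)" for n using finV finite_subset by blast
  have ball_mono: "ball m \<subseteq> ball n" if "m \<le> n" for m n
    using that by (rule lift_Suc_mono_le[rotated]) (auto simp: ball_Suc)
  have r_ball: "r \<in> ball n" for n using ball_mono[of 0 n] ball_0 by auto
  \<comment> \<open>Distance from \<open>r\<close>; the value matters only for vertices lying in
    some ball.\<close>
  define dist where "dist v = (LEAST n. v \<in> ball n)" for v
  have dist_le: "dist v \<le> n" if "v \<in> ball n" for v n
    unfolding dist_def using that by (rule Least_le)
  have in_ball_dist: "v \<in> ball (dist v)" if "v \<in> ball n" for v n
    unfolding dist_def using that by (rule LeastI)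
  have "\<exists>e\<in>E. \<exists>u. f e = {u, v} \<and> u \<in> ball n \<and> dist u < dist v"
    if vn: "v \<in> ball n" "v \<noteq> r" for v n
  proof -
    have v: "v \<in> ball (dist v)" using in_ball_dist vn(1) by blast
    then obtain m where m: "dist v = Suc m" using ball_0 vn(2) by (cases "dist v") auto
    have "v \<notin> ball m" using dist_le[of v m] m by auto
    then obtain e where e: "e \<in> E" "f e \<inter> ball m \<noteq> {}" "v \<in> f e" using v m ball_Suc by auto
    then obtain u where u: "u \<in> f e" "u \<in> ball m" by blast
    have "f e = {u, v}" using two[OF e(1)] u e(3) \<open>v \<notin> ball m\<close> by fastforce
    moreover have "dist u < dist v" using dist_le[OF u(2)] m by simp
    moreover have "u \<in> ball n"
      using ball_mono[of m n] u(2) dist_le[OF vn(1)] m by auto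
    ultimately show ?thesis using e(1) by blast
  qed
  \<comment> \<open>The radius \<open>n\<close> is replaced by \<open>dist v\<close>, so that one
    parent edge can be chosen for all balls at once.\<close>
  then have "\<forall>v. \<exists>e. \<forall>n. v \<in> ball n \<longrightarrow> v \<noteq> r \<longrightarrow>
      e \<in> E \<and> (\<exists>u. f e = {u, v} \<and> u \<in> ball (dist v) \<and> dist u < dist v)"
    using in_ball_dist by meson
  then obtain par where par: "\<And>v n. v \<in> ball n \<Longrightarrow> v \<noteq> r \<Longrightarrow>
      par v \<in> E \<and> (\<exists>u. f (par v) = {u, v} \<and> u \<in> ball (dist v) \<and> dist u < dist v)"
    by metis
  \<comment> \<open>An edge can be the parent edge only of its farther end.\<close>
  have inj: "inj_on par (ball n - {r})" for n
  proof (rule inj_onI)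
    fix v w assume vw: "v \<in> ball n - {r}" "w \<in> ball n - {r}" "par v = par w"
    obtain u u' where "f (par v) = {u, v}" "dist u < dist v" "f (par w) = {u', w}" "dist u' < dist w"
      using par vw by blast
    then show "v = w" using vw(3) by (metis doubleton_eq_iff less_asym)
  qed
  \<comment> \<open>A set closed under parents carries one tree edge for each vertex other than \<open>r\<close>.\<close>
  define anc where "anc W \<longleftrightarrow> r \<in> W \<and> (\<forall>w\<in>W - {r}. f (par w) \<subseteq> W)" for W
  \<comment> \<open>Distance drops at each step of the tree path from \<open>v\<close> to
    \<open>r\<close>, so it has at most \<open>dist v\<close> vertices besides
    \<open>r\<close>.\<close>
  have ancestors: "\<exists>W. anc W \<and> v \<in> W \<and> W \<subseteq> ball n \<and> card (W - {r}) \<le> dist v"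
    if "v \<in> ball n" for v n
    using that
  proof (induction "dist v" arbitrary: v rule: less_induct)
    case less
    show ?case
    proof (cases "v = r")
      case True
      then show ?thesis using r_ball by (intro exI[of _ "{r}"]) (auto simp: anc_def)
    next
      case False
      obtain u where u: "f (par v) = {u, v}" "u \<in> ball (dist v)" "dist u < dist v"
        using par[OF less.prems False] by blast
      have "u \<in> ball n" using ball_mono[OF dist_le[OF less.prems]] u(2) by blast
      from less.hyps[OF u(3) this] obtain W where
        W: "anc W" "u \<in> W" "W \<subseteq> ball n" "card (W - {r}) \<le> dist u" by blast
      have "card (insert v W - {r}) \<le> Suc (card (W - {r}))"
        using False W(3) fin_ball by (simp add: insert_Diff_if card_insert_le_m1 card_insert_if
            finite_subset)
      then show ?thesis
        using W u less.prems False by (intro exI[of _ "insert v W"]) (auto simp: anc_def)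
    qed
  qed
  have grow: "2 * card (ball j) \<le> card (ball (Suc j))" if "j < d" for j
  proof -
    define N where "N = {e \<in> E. f e \<inter> ball j \<noteq> {}}"
    define T where "T = par ` (ball (Suc j) - {r})"
    have finN: "finite N" unfolding N_def using finE by simp
    have N_ball: "f e \<subseteq> ball (Suc j)" if "e \<in> N" for e
      using that unfolding N_def ball_Suc by blast
    have TN: "T \<subseteq> N"
    proof
      fix e assume "e \<in> T"
      then obtain v where v: "v \<in> ball (Suc j)" "v \<noteq> r" "e = par v" unfolding T_def by auto
      then obtain u where u: "e \<in> E" "f e = {u, v}" "u \<in> ball (dist v)" "dist u < dist v"
        using par by blast
      have "dist u \<le> j" using u(4) dist_le[OF v(1)] by simp
      then have "u \<in> ball j" using in_ball_dist[OF u(3)] ball_mono by blast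
      then show "e \<in> N" unfolding N_def using u by auto
    qed
    have cT: "card T = card (ball (Suc j)) - 1"
      unfolding T_def using r_ball fin_ball by (simp add: card_image[OF inj])
    \<comment> \<open>One end has distance at most \<open>j\<close>, the other at most
      \<open>j + 1\<close>, and the lengths of their tree paths add up.\<close>
    have anc_edge: "\<exists>W. anc W \<and> f e \<subseteq> W \<and> W \<subseteq> ball (Suc j) \<and> card (W - {r}) \<le> 2 * j + 1"
      if eN: "e \<in> N" for e
    proof -
      obtain u where u: "u \<in> f e" "u \<in> ball j" using eN unfolding N_def by blast
      obtain a b where "f e = {a, b}" using two eN unfolding N_def by blast
      then obtain v where v: "f e = {u, v}"
        using u(1) by (metis insert_commute insert_iff singletonD)
      have v': "v \<in> ball (Suc j)" using N_ball[OF eN] v by simp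
      obtain W1 where W1: "anc W1" "u \<in> W1" "W1 \<subseteq> ball j" "card (W1 - {r}) \<le> dist u"
        using ancestors[OF u(2)] by blast
      obtain W2 where W2: "anc W2" "v \<in> W2" "W2 \<subseteq> ball (Suc j)" "card (W2 - {r}) \<le> dist v"
        using ancestors[OF v'] by blast
      have "card ((W1 \<union> W2) - {r}) \<le> card (W1 - {r}) + card (W2 - {r})"
        by (metis Un_Diff card_Un_le)
      also have "\<dots> \<le> 2 * j + 1"
        using W1(4) W2(4) dist_le[OF u(2)] dist_le[OF v'] by simp
      finally show ?thesis
        using W1 W2 v ball_mono[of j "Suc j"] by (intro exI[of _ "W1 \<union> W2"]) (auto simp: anc_def)
    qed
    \<comment> \<open>Two non-tree edges and the tree edges of \<open>W\<close> are together one
      more than the vertices of \<open>W\<close>. Their number is at most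
      \<open>(4 * j + 2) + 2\<close>, hence at most \<open>4 * d\<close> since
      \<open>j < d\<close>.\<close>
    have rest: "card (N - T) \<le> 1"
    proof (rule ccontr)
      assume "\<not> ?thesis"
      then obtain e g where eg: "e \<in> N - T" "g \<in> N - T" "e \<noteq> g"
        by (metis card_le_Suc0_iff_eq finN finite_Diff One_nat_def)
      obtain W1 where W1: "anc W1" "f e \<subseteq> W1" "W1 \<subseteq> ball (Suc j)" "card (W1 - {r}) \<le> 2 * j + 1"
        using anc_edge eg by blast
      obtain W2 where W2: "anc W2" "f g \<subseteq> W2" "W2 \<subseteq> ball (Suc j)" "card (W2 - {r}) \<le> 2 * j + 1"
        using anc_edge eg by blast
      define W where "W = W1 \<union> W2"
      define I where "I = insert e (insert g (par ` (W - {r})))"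
      have W: "anc W" "f e \<subseteq> W" "f g \<subseteq> W" "W \<subseteq> ball (Suc j)"
        using W1 W2 by (auto simp: W_def anc_def)
      then have finW: "finite W" using fin_ball finite_subset by blast
      have cW: "card (W - {r}) \<le> 4 * j + 2"
        using card_Un_le[of "W1 - {r}" "W2 - {r}"] W1(4) W2(4) by (simp add: W_def Un_Diff)
      have "inj_on par (W - {r})" using inj[of "Suc j"] W(4) by (auto intro: inj_on_subset)
      then have cp: "card (par ` (W - {r})) = card (W - {r})" by (rule card_image)
      have "par ` (W - {r}) \<subseteq> T" unfolding T_def using W(4) by auto
      then have cI: "card I = card (W - {r}) + 2"
        unfolding I_def using eg finW cp by (auto simp: card_insert_if)
      have "card I \<le> 4 * d" using cI cW \<open>j < d\<close> by simp
      moreover have "I \<subseteq> E"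
        unfolding I_def using eg TN \<open>par ` (W - {r}) \<subseteq> T\<close> by (auto simp: N_def)
      moreover have "card {e \<in> I. card (f e) = 1} \<le> 2"
      proof -
        \<comment> \<open>Tree edges join vertices at different distances, so only \<open>e\<close>
          and \<open>g\<close> can be loops.\<close>
        have "card (f (par w)) = 2" if w: "w \<in> W - {r}" for w
        proof -
          obtain u where "f (par w) = {u, w}" "dist u < dist w"
            using par[of w "Suc j"] w W(4) by blast
          then show ?thesis by (auto simp: card_insert_if)
        qed
        then have "{e \<in> I. card (f e) = 1} \<subseteq> {e, g}" unfolding I_def by fastforce
        from card_mono[OF _ this] show ?thesis using eg(3) by simp
      qed
      ultimately have "card I \<le> card (\<Union>e\<in>I. f e)" by (intro none)
      also have "\<dots> \<le> card W"
        using W finW unfolding I_def anc_def by (intro card_mono) auto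
      also have "card W = card (W - {r}) + 1"
        using W(1) finW by (metis Suc_eq_plus1 anc_def card_Suc_Diff1)
      finally show False using cI by simp
    qed
    have cN: "card N \<le> card (ball (Suc j))"
    proof -
      have "card N = card T + card (N - T)"
        using TN finN by (metis card_Diff_subset card_mono finite_subset le_add_diff_inverse)
      moreover have "card (ball (Suc j)) \<ge> 1"
        using r_ball fin_ball by (metis One_nat_def Suc_leI card_gt_0_iff empty_iff)
      ultimately show ?thesis using cT rest by simp
    qed
    define L where "L = par ` (ball (Suc j) - ball j)"
    have LN: "L \<subseteq> N" using TN r_ball unfolding L_def T_def by auto
    have cL: "card L = card (ball (Suc j)) - card (ball j)"
    proof -
      have "inj_on par (ball (Suc j) - ball j)"
        using inj[of "Suc j"] by (rule inj_on_subset) (use r_ball in auto)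
      then show ?thesis
        unfolding L_def using fin_ball ball_mono[of j "Suc j"] by (simp add: card_image card_Diff_subset)
    qed
    have one: "card (f e \<inter> ball j) \<le> 1" if eL: "e \<in> L" for e
    proof -
      obtain v where v: "v \<in> ball (Suc j)" "v \<notin> ball j" "e = par v" using eL L_def by auto
      then obtain u where "f e = {u, v}" using par[of v "Suc j"] r_ball by metis
      then have "f e \<inter> ball j \<subseteq> {u}" using v by auto
      from card_mono[OF _ this] show ?thesis by simp
    qed
    have le2: "card (f e \<inter> ball j) \<le> 2" if eN: "e \<in> N" for e
    proof -
      obtain u v where uv: "f e = {u, v}" using two eN N_def by blast
      have "card (f e \<inter> ball j) \<le> card {u, v}" unfolding uv by (rule card_mono) auto
      also have "\<dots> \<le> 2" by (simp add: card_insert_if)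
      finally show ?thesis .
    qed
    \<comment> \<open>Edges of \<open>L\<close> lead out of \<open>ball j\<close>, so they have only one end there.\<close>
    have "3 * card (ball j) = (\<Sum>v\<in>ball j. 3)" by simp
    also have "\<dots> \<le> (\<Sum>v\<in>ball j. card {e \<in> E. v \<in> f e})"
      by (intro sum_mono deg) (use ball_V in blast)
    also have "\<dots> = (\<Sum>v\<in>ball j. card {e \<in> N. v \<in> f e})"
      by (intro sum.cong refl arg_cong[of _ _ card]) (auto simp: N_def)
    also have "\<dots> = (\<Sum>e\<in>N. card {v \<in> ball j. v \<in> f e})"
      using sum.swap_restrict[OF fin_ball finN, of "\<lambda>_ _. 1::nat" "\<lambda>v e. v \<in> f e"] by simp
    also have "\<dots> = (\<Sum>e\<in>N. card (f e \<inter> ball j))"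
      by (intro sum.cong refl arg_cong[of _ _ card]) auto
    also have "\<dots> = (\<Sum>e\<in>N - L. card (f e \<inter> ball j)) + (\<Sum>e\<in>L. card (f e \<inter> ball j))"
      using LN finN by (rule sum.subset_diff)
    also have "\<dots> \<le> (\<Sum>e\<in>N - L. 2) + (\<Sum>e\<in>L. 1)"
      using le2 one by (intro add_mono sum_mono) auto
    also have "\<dots> = 2 * (card N - card L) + card L"
      using LN finN by (simp add: card_Diff_subset finite_subset)
    also have "\<dots> = 2 * card N - card L"
      using card_mono[OF finN LN] by simp
    \<comment> \<open>For the ball sizes \<open>b\<close> and \<open>b'\<close> the count gives
      \<open>3 b \<le> 2 b' - (b' - b)\<close>, that is \<open>2 b \<le> b'\<close>.\<close>
    finally show ?thesis using cN cL card_mono[OF fin_ball ball_mono, of j "Suc j"] by simp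
  qed
  have "2 ^ j \<le> card (ball j)" if "j \<le> d" for j
    using that
  proof (induction j)
    case 0
    then show ?case by (simp add: ball_0)
  next
    case (Suc j)
    then show ?case using grow[of j] by simp
  qed
  from this[of d] show False using d card_mono[OF finV ball_V, of d] by simp
qed

section \<open>The approximation ratio\<close>

theorem theorem1:
  fixes \<X> \<A> \<B> :: "'a set set" and k n :: nat
  assumes "k \<ge> 1"
    and "finite \<X>" and "card \<X> = n"
    and "\<forall>Y\<in>\<X>. finite Y \<and> card Y = k"
    and "packing \<X> \<A>"
    and "\<forall>Y\<in>\<X> - \<A>. \<exists>S\<in>\<A>. Y \<inter> S \<noteq> {}"
    and "\<forall>t::nat. real t \<le> 4 * log 2 (real n) + 1 \<longrightarrow>
           \<not> (\<exists>I. improvement \<X> \<A> t I \<and> canonical \<X> \<A> I)"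
    and "packing \<X> \<B>"
  shows "real (card \<B>) \<le> (real k + 2) / 3 * real (card \<A>)"
proof -

  \<comment> \<open>Conflict sets as ends of edges in the auxiliary multigraph\<close>
  define conf where "conf = conflicting \<A>"
  let ?G = "aux_graph \<X> \<A>"
  have AX: "\<A> \<subseteq> \<X>" and BX: "\<B> \<subseteq> \<X>"
    and disjA: "pairwise disjnt \<A>" and disjB: "pairwise disjnt \<B>"
    using assms(5,8) by (auto simp: packing_def)
  have finA: "finite \<A>" and finB: "finite \<B>" using AX BX assms(2) finite_subset by auto
  have ne: "Y \<noteq> {}" if "Y \<in> \<X>" for Y using assms(1,4) that by fastforce
  have conf_sub: "conf Y \<subseteq> \<A>" for Y by (auto simp: conf_def conflicting_def)
  then have fin_conf: "finite (conf Y)" for Y using finA finite_subset by blast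
  have conf_A: "conf Y = {Y}" if Y: "Y \<in> \<A>" for Y
    using Y disjA ne[of Y] AX by (auto simp: conf_def conflicting_def disjnt_def pairwise_def)
  have ends_eq: "ends ?G Y = conf Y" for Y
    using conf_A by (auto simp: aux_graph_def conf_def)
  have conf_pos: "1 \<le> card (conf Y)" if Y: "Y \<in> \<X>" for Y
  proof -
    have "conf Y \<noteq> {}"
    proof (cases "Y \<in> \<A>")
      case False
      then obtain S where "S \<in> \<A>" "Y \<inter> S \<noteq> {}" using assms(6) Y by blast
      then show ?thesis by (auto simp: conf_def conflicting_def disjnt_def)
    qed (simp add: conf_A)
    then show ?thesis using fin_conf by (simp add: Suc_leI card_gt_0_iff)
  qed
  define B1 where "B1 = {Y \<in> \<B>. card (conf Y) = 1}"
  define B2 where "B2 = {Y \<in> \<B>. card (conf Y) = 2}"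
  have B12: "B1 \<subseteq> \<B>" "B2 \<subseteq> \<B>" "finite B1" "finite B2"
    using finB by (auto simp: B1_def B2_def)
  have pair: "\<exists>u v. conf Y = {u, v}" if Y: "Y \<in> B1 \<union> B2" for Y
    using Y by (auto simp: B1_def B2_def card_1_singleton_iff card_2_iff)

  \<comment> \<open>Small edge sets from \<open>\<B>\<close> and canonical improvements\<close>
  have no_dense: "card I \<le> card (\<Union>Y\<in>I. conf Y)"
    if I: "I \<subseteq> B1 \<union> B2" "real (card I) \<le> 4 * log 2 (real n) + 1" for I
  proof (rule ccontr)
    assume "\<not> ?thesis"
    then have lt: "card (\<Union>Y\<in>I. ends ?G Y) < card I" by (simp add: ends_eq)
    have finI: "finite I" using I(1) B12 finite_subset by blast
    have "\<forall>Y\<in>I. \<exists>u v. ends ?G Y = {u, v}" using pair I(1) unfolding ends_eq by blast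
    from exists_bicyclic_edge_subset[OF finI this lt] obtain J where
      J: "J \<subseteq> I" "card (\<Union>Y\<in>J. ends ?G Y) < card J" "bicyclic (edge_subgraph ?G J)" .
    have JB: "J \<subseteq> B1 \<union> B2" using J(1) I(1) by blast
    have "improvement \<X> \<A> (card J) J"
      unfolding improvement_def
    proof (intro conjI)
      show "J \<subseteq> edges ?G"
        using JB BX by (auto simp: aux_graph_def B1_def B2_def conf_def)
      \<comment> \<open>Edges taken from the packing \<open>\<B>\<close> are disjoint as sets, so an
        improvement is only a matter of counting.\<close>
      show "pairwise disjnt J" by (rule pairwise_subset[OF disjB]) (use JB B12 in blast)
      show "finite J" using J(1) finI finite_subset by blast
    qed (use J(2) in auto)
    moreover have "canonical \<X> \<A> J"
      using J(3) by (simp add: canonical_def bicyclic_def Let_def)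
    moreover have "real (card J) \<le> 4 * log 2 (real n) + 1"
      using card_mono[OF finI J(1)] I(2) by linarith
    ultimately show False using assms(7) by blast
  qed
  \<comment> \<open>Two or three edges force \<open>n \<ge> 2\<close>, so the size bound is at least
    5.\<close>
  have small: "real t \<le> 4 * log 2 (real n) + 1" if t: "t \<le> 3" "t \<le> n" "2 \<le> t" for t
  proof -
    have "1 \<le> log 2 (real n)" using t by (simp add: le_log_iff)
    moreover have "real t \<le> 3" using t(1) by simp
    ultimately show ?thesis by linarith
  qed
  have card_n: "card I \<le> n" if "I \<subseteq> \<X>" for I
    using card_mono[OF assms(2) that] assms(3) by simp

  \<comment> \<open>Loops coming from \<open>\<B>\<close>\<close>
  define A1 where "A1 = (\<Union>Y\<in>B1. conf Y)"
  define A2 where "A2 = \<A> - A1"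
  have A1A: "A1 \<subseteq> \<A>" using conf_sub by (auto simp: A1_def)
  \<comment> \<open>Two sets with the same single conflict would be two edges on one vertex.\<close>
  have inj_loops: "inj_on conf B1"
  proof (rule inj_onI, rule ccontr)
    fix Y Z assume YZ: "Y \<in> B1" "Z \<in> B1" "conf Y = conf Z" "Y \<noteq> Z"
    have "card {Y, Z} \<le> n" using YZ B12 BX by (intro card_n) auto
    then have "card {Y, Z} \<le> card (\<Union>W\<in>{Y, Z}. conf W)"
      using YZ by (intro no_dense small) auto
    then show False using YZ by (simp add: B1_def)
  qed
  \<comment> \<open>Each vertex of \<open>A1\<close> carries exactly one loop from
    \<open>B1\<close>. The count is relative to \<open>S\<close> because only loops at the vertices
    of a given edge set get added later.\<close>
  have card_loops: "card {Y \<in> B1. conf Y \<subseteq> S} = card (A1 \<inter> S)" for S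
  proof -
    have "A1 \<inter> S = (\<Union>Y\<in>{Y \<in> B1. conf Y \<subseteq> S}. conf Y)"
      by (fastforce simp: A1_def B1_def card_1_singleton_iff)
    also have "card \<dots> = (\<Sum>Y\<in>{Y \<in> B1. conf Y \<subseteq> S}. card (conf Y))"
    proof (intro card_UN_disjoint ballI impI)
      fix Y Z assume YZ: "Y \<in> {Y \<in> B1. conf Y \<subseteq> S}" "Z \<in> {Y \<in> B1. conf Y \<subseteq> S}" "Y \<noteq> Z"
      then obtain s t where "conf Y = {s}" "conf Z = {t}"
        by (auto simp: B1_def card_1_singleton_iff)
      moreover have "conf Y \<noteq> conf Z" using YZ inj_onD[OF inj_loops] by blast
      ultimately show "conf Y \<inter> conf Z = {}" by simp
    qed (simp_all add: B12 fin_conf)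
    also have "\<dots> = card {Y \<in> B1. conf Y \<subseteq> S}" by (simp add: B1_def)
    finally show ?thesis by simp
  qed
  have card_B1: "card B1 = card A1"
  proof -
    have "{Y \<in> B1. conf Y \<subseteq> A1} = B1" by (auto simp: A1_def)
    then show ?thesis using card_loops[of A1] by simp
  qed

  \<comment> \<open>Edges with the vertices of \<open>A1\<close> deleted\<close>
  define E where "E Y = conf Y - A1" for Y
  \<comment> \<open>If both ends lay in \<open>A1\<close>, then \<open>Y\<close> and the loops at
    its ends would be three edges on two vertices.\<close>
  have E_ne: "E Y \<noteq> {}" if Y: "Y \<in> B2" for Y
  proof
    assume "E Y = {}"
    then have sub: "conf Y \<subseteq> A1" by (auto simp: E_def)
    let ?L = "{Z \<in> B1. conf Z \<subseteq> conf Y}"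
    have "Y \<notin> ?L" using Y by (auto simp: B1_def B2_def)
    have "finite ?L" using B12(3) by simp
    have L2: "card ?L = 2" using card_loops[of "conf Y"] sub Y
      by (simp add: B2_def Int_absorb1)
    then have c: "card (insert Y ?L) = 3" using \<open>Y \<notin> ?L\<close> \<open>finite ?L\<close> by simp
    have "insert Y ?L \<subseteq> \<X>" using Y B12 BX by auto
    from card_n[OF this] have "3 \<le> card (\<Union>W\<in>insert Y ?L. conf W)"
      using no_dense[of "insert Y ?L"] small[of 3] Y c by auto
    also have "(\<Union>W\<in>insert Y ?L. conf W) = conf Y" by auto
    finally show False using Y by (simp add: B2_def)
  qed
  have E_A2: "E Y \<subseteq> A2" for Y using conf_sub by (auto simp: E_def A2_def)

  \<comment> \<open>Adding the loops at the vertices of \<open>A1\<close> met by \<open>I\<close> adds as many edges as vertices.\<close>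
  have lift: "card I \<le> card (\<Union>Y\<in>I. E Y)"
    if I: "I \<subseteq> B2" "card {Y \<in> I. card (E Y) = 1} \<le> 2"
      "real (card I) + 2 \<le> 4 * log 2 (real n) + 1" for I
  proof -
    have finI: "finite I" using I(1) B12 finite_subset by blast
    define U where "U = (\<Union>Y\<in>I. conf Y)"
    have finU: "finite U" using finI fin_conf by (auto simp: U_def)
    define L where "L = {Y \<in> B1. conf Y \<subseteq> U}"
    have cL: "card L = card (A1 \<inter> U)" unfolding L_def by (rule card_loops)
    \<comment> \<open>An edge of \<open>I\<close> meets \<open>A1\<close> only if its truncation is
      a loop, and then in a single vertex; \<open>I\<close> has at most two such edges.\<close>
    have "card (A1 \<inter> U) \<le> 2"
    proof -
      have one: "card (A1 \<inter> conf Y) \<le> 1 \<and> (A1 \<inter> conf Y \<noteq> {} \<longrightarrow> card (E Y) = 1)"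
        if Y: "Y \<in> I" for Y
      proof -
        have "card (A1 \<inter> conf Y) + card (E Y) = 2"
          using card_Int_Diff[of "conf Y" A1] fin_conf Y I(1)
          by (auto simp: E_def B2_def Int_commute)
        moreover have "card (E Y) \<noteq> 0"
          using E_ne[of Y] Y I(1) fin_conf[of Y] by (auto simp: E_def)
        moreover have "card (A1 \<inter> conf Y) \<noteq> 0" if "A1 \<inter> conf Y \<noteq> {}"
          using that fin_conf[of Y] by auto
        ultimately show ?thesis by linarith
      qed
      have "A1 \<inter> U = (\<Union>Y\<in>{Y \<in> I. card (E Y) = 1}. A1 \<inter> conf Y)"
        unfolding U_def using one by fastforce
      also have "card \<dots> \<le> (\<Sum>Y\<in>{Y \<in> I. card (E Y) = 1}. card (A1 \<inter> conf Y))"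
        using finI by (intro card_UN_le) auto
      also have "\<dots> \<le> (\<Sum>Y\<in>{Y \<in> I. card (E Y) = 1}. 1)"
        using one by (intro sum_mono) auto
      finally show ?thesis using I(2) by simp
    qed
    then have cL2: "card L \<le> 2" using cL by simp
    have "I \<inter> L = {}" using I(1) by (auto simp: L_def B1_def B2_def)
    then have cIL: "card (I \<union> L) = card I + card L"
      using finI B12 by (intro card_Un_disjoint) (auto simp: L_def)
    then have "card I + card L \<le> card (\<Union>Y\<in>I \<union> L. conf Y)"
      using no_dense[of "I \<union> L"] I cL2 by (auto simp: L_def)
    also have "(\<Union>Y\<in>I \<union> L. conf Y) = U" by (auto simp: U_def L_def)
    also have "card U = card (A1 \<inter> U) + card (\<Union>Y\<in>I. E Y)"
    proof -
      have "U - A1 = (\<Union>Y\<in>I. E Y)" by (auto simp: U_def E_def)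
      then show ?thesis using card_Int_Diff[OF finU, of A1] by (simp add: Int_commute)
    qed
    finally show ?thesis using cL by simp
  qed

  \<comment> \<open>At most two edges of \<open>B2\<close> per vertex of \<open>A2\<close>\<close>
  have "card B2 \<le> 2 * card A2"
  proof (rule ccontr)
    assume "\<not> ?thesis"
    then have many: "2 * card A2 < card B2" by simp
    define EV where "EV V = {Y \<in> B2. E Y \<subseteq> V}" for V
    have "EV A2 = B2" using E_A2 by (auto simp: EV_def)
    then have "2 * card A2 < card (EV A2)" using many by simp
    \<comment> \<open>In a smallest \<open>V\<close> with more than two edges per vertex all degrees
      are at least 3, since deleting a vertex of degree at most 2 keeps that density.\<close>
    then obtain V where V: "V \<subseteq> A2" "2 * card V < card (EV V)"
      and min: "\<And>V'. V' \<subseteq> A2 \<Longrightarrow> 2 * card V' < card (EV V') \<Longrightarrow> card V \<le> card V'"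
      using ex_has_least_nat[of "\<lambda>V. V \<subseteq> A2 \<and> 2 * card V < card (EV V)" A2 card] by auto
    have finA2: "finite A2" using finA by (simp add: A2_def)
    then have finV: "finite V" using V(1) finite_subset by blast
    have finEV: "finite (EV W)" for W using B12 by (simp add: EV_def)
    have "EV {} = {}" using E_ne by (auto simp: EV_def)
    then have Vne: "V \<noteq> {}" using V(2) by auto
    have deg: "3 \<le> card {Y \<in> EV V. v \<in> E Y}" if v: "v \<in> V" for v
    proof (rule ccontr)
      assume "\<not> ?thesis"
      then have le: "card {Y \<in> EV V. v \<in> E Y} \<le> 2" by simp
      have "EV V = EV (V - {v}) \<union> {Y \<in> EV V. v \<in> E Y}" by (auto simp: EV_def)
      then have "card (EV V) \<le> card (EV (V - {v})) + card {Y \<in> EV V. v \<in> E Y}"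
        by (metis card_Un_le)
      moreover have "card V = Suc (card (V - {v}))" by (rule card.remove[OF finV v])
      ultimately have "2 * card (V - {v}) < card (EV (V - {v}))" using le V(2) by linarith
      then have "card V \<le> card (V - {v})" using min V(1) by blast
      then show False using \<open>card V = _\<close> by simp
    qed
    \<comment> \<open>The sets of \<open>A2\<close> and the more than twice as many sets of
      \<open>B2\<close> are distinct members of \<open>\<X>\<close>.\<close>
    have n3: "3 * card V < n"
    proof -
      have "\<A> \<inter> B2 = {}" using conf_A by (auto simp: B2_def)
      then have "card A2 + card B2 = card (A2 \<union> B2)"
        using finA2 B12 by (intro card_Un_disjoint[symmetric]) (auto simp: A2_def)
      also have "\<dots> \<le> n" using AX BX B12 by (intro card_n) (auto simp: A2_def)
      finally show ?thesis using many card_mono[OF finA2 V(1)] by linarith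
    qed
    \<comment> \<open>Minimality of \<open>d\<close> gives \<open>2 ^ d \<le> 2 * card V\<close>,
      which turns \<open>4 * d\<close> into a multiple of the logarithm.\<close>
    define d where "d = (LEAST d. card V < 2 ^ d)"
    have "card V < 2 ^ card V" by (rule less_exp)
    then have d: "card V < 2 ^ d" unfolding d_def by (rule LeastI)
    have "d \<noteq> 0" using d Vne finV by (cases d) auto
    then have "\<not> card V < 2 ^ (d - 1)" unfolding d_def by (intro not_less_Least) simp
    then have d2: "2 ^ d \<le> 2 * card V" using \<open>d \<noteq> 0\<close> by (cases d) auto
    have two: "\<exists>u v. E Y = {u, v}" if Y: "Y \<in> EV V" for Y
    proof -
      have YB: "Y \<in> B2" using Y by (simp add: EV_def)
      obtain u v where "conf Y = {u, v}" using pair[of Y] YB by blast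
      then have "E Y \<subseteq> {u, v}" by (auto simp: E_def)
      then have "E Y = {u, u} \<or> E Y = {v, v} \<or> E Y = {u, v}" using E_ne[OF YB] by blast
      then show ?thesis by blast
    qed
    obtain I where I: "I \<subseteq> EV V" "card (\<Union>Y\<in>I. E Y) < card I" "card I \<le> 4 * d"
      "card {Y \<in> I. card (E Y) = 1} \<le> 2"
      using small_dense_edge_set[OF finV Vne finEV _ two deg d] by (auto simp: EV_def)
    \<comment> \<open>\<open>lift\<close> needs room for two loops: one is covered by the
      \<open>+ 1\<close> of the size bound, the other by the \<open>+ 1\<close> here, which is
      affordable because \<open>2 * 2 ^ 4 = 32 \<le> 81 = 3 ^ 4\<close>.\<close>
    have "real (4 * d + 1) \<le> 4 * log 2 (real n)"
    proof -
      have "(2::nat) ^ (4 * d + 1) = 2 * (2 ^ d) ^ 4" by (simp add: power_mult mult.commute)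
      also have "\<dots> \<le> 2 * (2 * card V) ^ 4" using d2 by (intro mult_left_mono power_mono) auto
      also have "\<dots> \<le> (3 * card V) ^ 4" by (simp add: power_mult_distrib)
      also have "\<dots> \<le> n ^ 4" using n3 by (intro power_mono) auto
      finally have "real (2 ^ (4 * d + 1)) \<le> real (n ^ 4)" by (rule of_nat_mono)
      then have "log 2 (2 ^ (4 * d + 1)) \<le> log 2 (real n ^ 4)"
        using n3 by (subst log_le_cancel_iff) auto
      moreover have "log 2 (2 ^ (4 * d + 1)) = real (4 * d + 1)" by (rule log_pow_cancel) auto
      moreover have "log 2 (real n ^ 4) = 4 * log 2 (real n)" using n3 by (simp add: log_nat_power)
      ultimately show ?thesis by (simp only:)
    qed
    then have "real (card I) + 2 \<le> 4 * log 2 (real n) + 1" using I(3) by linarith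
    then have "card I \<le> card (\<Union>Y\<in>I. E Y)"
      using I by (intro lift) (auto simp: EV_def)
    then show False using I(2) by simp
  qed
  moreover have "card \<A> = card A1 + card A2"
    using A1A finA card_Diff_subset[of A1 \<A>] card_mono[of \<A> A1] finite_subset[of A1 \<A>]
    by (simp add: A2_def)
  ultimately have few: "2 * card B1 + card B2 \<le> 2 * card \<A>" using card_B1 by simp

  have "3 * card \<B> \<le> (\<Sum>Y\<in>\<B>. card (conf Y)) + 2 * card B1 + card B2"
  proof -
    have "3 * card \<B> = (\<Sum>Y\<in>\<B>. 3)" by simp
    \<comment> \<open>Maximality leaves no set without a conflict, and the weights raise one or two
      conflicts to three.\<close>
    also have "\<dots> \<le> (\<Sum>Y\<in>\<B>. card (conf Y) +
        2 * (if card (conf Y) = 1 then 1 else 0) + (if card (conf Y) = 2 then 1 else 0))"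
      using conf_pos BX by (intro sum_mono) fastforce
    also have "\<dots> = (\<Sum>Y\<in>\<B>. card (conf Y)) + 2 * card B1 + card B2"
      using finB by (simp add: sum.distrib sum_distrib_left[symmetric] B1_def B2_def
        sum.inter_filter[symmetric])
    finally show ?thesis .
  qed
  moreover have "(\<Sum>Y\<in>\<B>. card (conf Y)) \<le> k * card \<A>"
  proof -
    have "(\<Sum>Y\<in>\<B>. card (conf Y)) = (\<Sum>S\<in>\<A>. card {Y \<in> \<B>. \<not> disjnt S Y})"
      using sum.swap_restrict[OF finB finA, of "\<lambda>_ _. 1::nat" "\<lambda>Y S. \<not> disjnt S Y"]
      by (simp add: conf_def conflicting_def)
    also have "\<dots> \<le> (\<Sum>S\<in>\<A>. k)"
    proof (rule sum_mono)
      fix S assume S: "S \<in> \<A>"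
      \<comment> \<open>Pairwise disjoint sets meet \<open>S\<close> in different elements, of which
        it has \<open>k\<close>.\<close>
      have "\<forall>Y\<in>{Y \<in> \<B>. \<not> disjnt S Y}. \<exists>x. x \<in> S \<inter> Y" by (auto simp: disjnt_def)
      then obtain g where g: "\<And>Y. Y \<in> {Y \<in> \<B>. \<not> disjnt S Y} \<Longrightarrow> g Y \<in> S \<inter> Y" by metis
      have "inj_on g {Y \<in> \<B>. \<not> disjnt S Y}"
      proof (rule inj_onI, rule ccontr)
        fix Y Z assume YZ: "Y \<in> {Y \<in> \<B>. \<not> disjnt S Y}" "Z \<in> {Y \<in> \<B>. \<not> disjnt S Y}"
          "g Y = g Z" "Y \<noteq> Z"
        then have "disjnt Y Z" using disjB by (auto simp: pairwise_def)
        moreover have "g Y \<in> Y \<inter> Z" using g[OF YZ(1)] g[OF YZ(2)] YZ(3) by simp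
        ultimately show False by (auto simp: disjnt_def)
      qed
      moreover have "finite S" "card S = k" using S AX assms(4) by auto
      ultimately show "card {Y \<in> \<B>. \<not> disjnt S Y} \<le> k"
        using card_inj_on_le[of g "{Y \<in> \<B>. \<not> disjnt S Y}" S] g by blast
    qed
    finally show ?thesis by (simp add: mult.commute)
  qed
  ultimately have "3 * card \<B> \<le> (k + 2) * card \<A>" using few by (simp add: algebra_simps)
  then have "real (3 * card \<B>) \<le> real ((k + 2) * card \<A>)" by (rule of_nat_mono)
  then show ?thesis by (simp add: field_simps)
qed

end
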